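(* Let $d'>d\ge1$, $n'>n\ge 1$ and $m,m'\ge 1$ be integers. Let $\mathcal M=\{u_1,\ldots,u_m\}\subset T_n$ and $\mathcal M'=\{v_1,\ldots,v_{m'}\}\subset T_{n'}$ be two sets of monomials such that: (i) $\deg(u_i)=d$ for all $1\le i\le m$; (ii) $\deg(v_i)\le d'-d$ for all $1\le i\le m'$; (iii) $\operatorname{supp}(v_i)\subset\{x_{n+1},\ldots,x_{n'}\}$ for all $1\le i\le m'$; (iv) $\mathcal M$ (in $T_n$) and $\mathcal M'$ (in $T_{n'}$) are smoothly spreadable. Then the set $\{u_iv_k : 1\le i\le m,\ 1\le k\le m'\}\subset T_{n'}$ is smoothly spreadable. In particular, the ideal $$I:=(u_1,\ldots,u_m)\cdot(v_1,\ldots,v_{m'})=(u_1,\ldots,u_m)\cap(v_1,\ldots,v_{m'})\subset T_{n'}$$ is smoothly spreadable.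
   Context: $K$ is a field, $T=K[x_1,x_2,\ldots]$ and $T_n=K[x_1,\ldots,x_n]$. The support of a monomial $u$ is $\operatorname{supp}(u)=\{x_j:x_j\mid u\}$. For a monomial $u=x_{i_1}\cdots x_{i_d}$ with $i_1\le\cdots\le i_d$, set $\sigma(u):=x_{i_1}x_{i_2+1}\cdots x_{i_d+d-1}$, and $\sigma^t(u):=\sigma(\sigma^{t-1}(u))$, so $\sigma^t(u)=x_{i_1}x_{i_2+t}\cdots x_{i_d+(d-1)t}$. For a monomial $u=x_1^{a_1}\cdots x_n^{a_n}\in T_n$, its polarization with respect to $T_n$ is $u^p:=\prod_{j=1}^n\prod_{k=0}^{a_j-1}x_{kn+j}$. Smoothly spreadable: let $d,m>0$ be integers and let $\mathcal M=\{u_1,\ldots,u_m\}\subset T_n$ be a set of monomials with $\deg(u_i)\le d$ for all $i$. $\mathcal M$ is smoothly spreadable if there is a permutation $\tau$ of $\{1,\ldots,nd\}$ with $\tau(j)\equiv j\pmod n$ for all $j$ such that the $K$-algebra isomorphism $\Phi:T_{nd}\to T_{nd}$, $\Phi(x_j)=x_{\tau(j)}$, satisfies $\Phi(\sigma^n(u_i))=u_i^p$ for all $i$. In the statement the degree bounds used are $d$ for $\mathcal M\subset T_n$, $d'-d$ for $\mathcal M'\subset T_{n'}$ and $d'$ for the product set in $T_{n'}$ (for sets in $T_{n'}$, replace $n$ by $n'$ everywhere, including in the polarization). A monomial ideal $I$ is smoothly spreadable if its set $G(I)$ of minimal monomial generators is smoothly spreadable, with degree bound $\deg(I)$, the maximal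 degree of an element of $G(I)$. *)

theory Defs
  imports
    "HOL-Library.Poly_Mapping"
    "HOL-Library.Multiset"
    "HOL-Combinatorics.Permutations"
    "HOL-Number_Theory.Cong"
    "HOL-Algebra.Ideal_Product"
    "HOL-Algebra.QuotRing"
begin

text \<open>
  A monomial is encoded by its exponent multiset: \<open>u\<close> stands for the product of the variables
  \<open>x\<^sub>j\<close>, \<open>j \<in># u\<close>, with multiplicity. Hence \<open>size u\<close> is the degree, \<open>set_mset u\<close> the set of
  indices of the support, \<open>count u j\<close> the exponent of \<open>x\<^sub>j\<close>, \<open>u + v\<close> the product and
  \<open>u \<subseteq># v\<close> divisibility. Polynomials are finitely supported functions from monomials to
  coefficients; the multiplication of the type is the convolution product.
  The type has a variable with index \<open>0\<close>, which is excluded by the carrier of \<open>T n\<close>.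
\<close>

type_synonym monom = "nat multiset"
type_synonym 'k polynomial = "monom \<Rightarrow>\<^sub>0 'k"

definition monomial :: "monom \<Rightarrow> 'k::field polynomial" where
  "monomial u = Poly_Mapping.single u 1"

definition var :: "nat \<Rightarrow> 'k::field polynomial" where
  "var j = monomial {#j#}"

definition const :: "'k::field \<Rightarrow> 'k polynomial" where
  "const c = Poly_Mapping.single {#} c"

definition T :: "nat \<Rightarrow> 'k::field polynomial ring" where
  "T n = \<lparr>carrier = {f. \<forall>u \<in> Poly_Mapping.keys f. set_mset u \<subseteq> {1..n}},
          mult = (*), one = 1, zero = 0, add = (+)\<rparr>"

definition monomials :: "nat \<Rightarrow> 'k::field polynomial set" where
  "monomials n = monomial ` {u. set_mset u \<subseteq> {1..n}}"

definition alg_iso :: "nat \<Rightarrow> nat \<Rightarrow> ('k::field polynomial \<Rightarrow> 'k polynomial) set" where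
  "alg_iso m n = {\<Phi> \<in> ring_iso (T m) (T n). \<forall>c. \<Phi> (const c) = const c}"

definition \<sigma> :: "monom \<Rightarrow> monom" where
  "\<sigma> u = mset (map2 (+) (sorted_list_of_multiset u) [0..<size u])"

definition polarization :: "nat \<Rightarrow> monom \<Rightarrow> monom" where
  "polarization n u = (\<Sum>j\<in>{1..n}. \<Sum>k<count u j. {#k * n + j#})"

text \<open>
  The second argument is the degree bound. The isomorphism \<open>\<Phi>\<close> is determined on \<open>T (n * d)\<close>
  by \<open>\<tau>\<close>; its values outside of this carrier are irrelevant.
\<close>

definition smoothly_spreadable :: "nat \<Rightarrow> nat \<Rightarrow> 'k::field polynomial set \<Rightarrow> bool" where
  "smoothly_spreadable n d M \<longleftrightarrow>
     d > 0 \<and> finite M \<and> M \<noteq> {} \<and> M \<subseteq> monomials n \<and>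
     (\<forall>u. monomial u \<in> M \<longrightarrow> size u \<le> d) \<and>
     (\<exists>\<tau> \<Phi>. \<tau> permutes {1..n * d} \<and> (\<forall>j\<in>{1..n * d}. [\<tau> j = j] (mod n)) \<and>
        \<Phi> \<in> alg_iso (n * d) (n * d) \<and>
        (\<forall>j\<in>{1..n * d}. \<Phi> (var j) = (var (\<tau> j) :: 'k polynomial)) \<and>
        (\<forall>u. monomial u \<in> M \<longrightarrow> \<Phi> (monomial ((\<sigma> ^^ n) u)) = monomial (polarization n u)))"

definition monomial_ideal :: "nat \<Rightarrow> 'k::field polynomial set \<Rightarrow> bool" where
  "monomial_ideal n I \<longleftrightarrow> (\<exists>S \<subseteq> monomials n. I = Idl\<^bsub>T n\<^esub> S)"

definition minimal_monomial_generators ::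
    "nat \<Rightarrow> 'k::field polynomial set \<Rightarrow> 'k polynomial set \<Rightarrow> bool" where
  "minimal_monomial_generators n I G \<longleftrightarrow>
     G \<subseteq> monomials n \<and> Idl\<^bsub>T n\<^esub> G = I \<and> (\<forall>H. H \<subset> G \<longrightarrow> Idl\<^bsub>T n\<^esub> H \<noteq> I)"

definition min_gens :: "nat \<Rightarrow> 'k::field polynomial set \<Rightarrow> 'k polynomial set" where
  "min_gens n I = (THE G. minimal_monomial_generators n I G)"

definition ideal_deg :: "nat \<Rightarrow> 'k::field polynomial set \<Rightarrow> nat" where
  "ideal_deg n I = Max {size u | u. monomial u \<in> min_gens n I}"

definition smoothly_spreadable_ideal :: "nat \<Rightarrow> 'k::field polynomial set \<Rightarrow> bool" where
  "smoothly_spreadable_ideal n I \<longleftrightarrow>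
     monomial_ideal n I \<and> smoothly_spreadable n (ideal_deg n I) (min_gens n I)"

lemma monomial_eq_iff [simp]: "(monomial u :: 'k::field polynomial) = monomial v \<longleftrightarrow> u = v"
  unfolding monomial_def by (metis lookup_single_eq lookup_single_not_eq zero_neq_one)

lemma monomial_mult: "(monomial u :: 'k::field polynomial) * monomial v = monomial (u + v)"
  by (simp add: monomial_def mult_single)

lemma cring_T: "cring (T n :: 'k::field polynomial ring)"
proof (rule cringI)
  show "abelian_group (T n :: 'k polynomial ring)"
  proof (rule abelian_groupI)
    fix f g :: "'k polynomial"
    assume "f \<in> carrier (T n)" "g \<in> carrier (T n)"
    then show "f \<oplus>\<^bsub>T n\<^esub> g \<in> carrier (T n)"
      unfolding T_def using keys_add[of f g] by auto
  next
    fix f :: "'k polynomial"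
    assume "f \<in> carrier (T n)"
    then have "- f \<in> carrier (T n)" by (auto simp: T_def in_keys_iff)
    then show "\<exists>g\<in>carrier (T n). g \<oplus>\<^bsub>T n\<^esub> f = \<zero>\<^bsub>T n\<^esub>"
      by (rule bexI[rotated]) (simp add: T_def)
  qed (auto simp: T_def ac_simps)
  show "comm_monoid (T n :: 'k polynomial ring)"
  proof (rule comm_monoidI)
    fix f g :: "'k polynomial"
    assume fg: "f \<in> carrier (T n)" "g \<in> carrier (T n)"
    show "f \<otimes>\<^bsub>T n\<^esub> g \<in> carrier (T n)"
    proof -
      have "set_mset w \<subseteq> {1..n}" if w: "w \<in> Poly_Mapping.keys (f * g)" for w
      proof -
        obtain a b where "w = a + b" "a \<in> Poly_Mapping.keys f" "b \<in> Poly_Mapping.keys g"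
          using keys_mult[of f g] w by auto
        then show ?thesis using fg by (simp add: T_def)
      qed
      then show ?thesis by (simp add: T_def)
    qed
  qed (auto simp: T_def ac_simps)
qed (auto simp: T_def distrib_right)

text \<open>
  Minimal monomial generating sets are unique, so the definite description in \<open>min_gens\<close>
  denotes the set usually written \<open>G(I)\<close>.
\<close>

lemma monomial_in_Idl_imp_dvd:
  fixes S :: "'k::field polynomial set"
  assumes S: "S \<subseteq> monomials n" and u: "monomial u \<in> Idl\<^bsub>T n\<^esub> S"
  shows "\<exists>a. monomial a \<in> S \<and> a \<subseteq># u"
proof -
  interpret R: cring "T n :: 'k polynomial ring" by (rule cring_T)
  define P where "P w \<longleftrightarrow> (\<exists>a. monomial a \<in> S \<and> a \<subseteq># w)" for w
  define J :: "'k polynomial set" where "J = {f \<in> carrier (T n). \<forall>w\<in>Poly_Mapping.keys f. P w}"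
  have P_add: "P (a + b)" if "P a \<or> P b" for a b
    using that unfolding P_def
    by (meson mset_subset_eq_add_left mset_subset_eq_add_right subset_mset.order_trans)
  have minus: "\<ominus>\<^bsub>T n\<^esub> f = - f" if "f \<in> carrier (T n)" for f :: "'k polynomial"
  proof -
    have "- f \<oplus>\<^bsub>T n\<^esub> f = \<zero>\<^bsub>T n\<^esub>" by (simp add: T_def)
    moreover have "- f \<in> carrier (T n)" using that by (auto simp: T_def in_keys_iff)
    ultimately show ?thesis using R.minus_equality that by blast
  qed
  have "ideal J (T n)"
  proof (rule idealI)
    show "ring (T n :: 'k polynomial ring)" by (rule R.ring_axioms)
    show "subgroup J (add_monoid (T n))"
    proof (rule R.add.subgroupI)
      show "J \<subseteq> carrier (T n)" by (auto simp: J_def)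
      show "J \<noteq> {}"
        using R.zero_closed by (auto simp: J_def T_def intro!: exI[of _ 0])
      fix f assume f: "f \<in> J"
      then have "- f \<in> J" by (auto simp: J_def T_def in_keys_iff)
      then show "\<ominus>\<^bsub>T n\<^esub> f \<in> J" using minus f by (simp add: J_def)
      fix g assume g: "g \<in> J"
      have "f \<oplus>\<^bsub>T n\<^esub> g \<in> carrier (T n)" using f g by (auto simp: J_def)
      moreover have "\<forall>w\<in>Poly_Mapping.keys (f + g). P w"
        using f g keys_add[of f g] by (auto simp: J_def)
      ultimately show "f \<oplus>\<^bsub>T n\<^esub> g \<in> J" by (simp add: J_def T_def)
    qed
    fix f g :: "'k polynomial"
    assume f: "f \<in> J" and g: "g \<in> carrier (T n)"
    have fg: "g \<otimes>\<^bsub>T n\<^esub> f \<in> carrier (T n)" using f g by (auto simp: J_def)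
    have "\<forall>w\<in>Poly_Mapping.keys (g * f). P w"
      using f keys_mult[of g f] P_add by (fastforce simp: J_def)
    with fg show "g \<otimes>\<^bsub>T n\<^esub> f \<in> J" by (simp add: J_def T_def)
    then show "f \<otimes>\<^bsub>T n\<^esub> g \<in> J" using f g by (simp add: J_def R.m_comm)
  qed
  moreover have "S \<subseteq> J"
  proof
    fix f assume "f \<in> S"
    then obtain a where "f = monomial a" "set_mset a \<subseteq> {1..n}" using S by (auto simp: monomials_def)
    with \<open>f \<in> S\<close> show "f \<in> J" by (auto simp: J_def T_def P_def monomial_def)
  qed
  ultimately have "monomial u \<in> J" using u by (auto simp: genideal_def)
  then show ?thesis by (simp add: J_def P_def monomial_def)
qed

lemma minimal_monomial_generators_unique:
  fixes I :: "'k::field polynomial set"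
  assumes G: "minimal_monomial_generators n I G" and H: "minimal_monomial_generators n I H"
  shows "G = H"
proof -
  interpret R: cring "T n :: 'k polynomial ring" by (rule cring_T)
  have carr: "S \<subseteq> carrier (T n)" if "S \<subseteq> monomials n" for S :: "'k polynomial set"
    using that by (force simp: monomials_def T_def monomial_def)
  have anti: "a = b" if G: "minimal_monomial_generators n I G"
    and ab: "monomial a \<in> G" "monomial b \<in> G" "a \<subseteq># b" for a b and G :: "'k polynomial set"
  proof (rule ccontr)
    assume ne: "a \<noteq> b"
    define G' where "G' = G - {monomial b}"
    have sub: "G \<subseteq> monomials n" and I: "I = Idl\<^bsub>T n\<^esub> G"
      using G by (auto simp: minimal_monomial_generators_def)
    have cG: "G \<subseteq> carrier (T n)" and cG': "G' \<subseteq> carrier (T n)"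
      using carr[OF sub] by (auto simp: G'_def)
    interpret Id: ideal "Idl\<^bsub>T n\<^esub> G'" "T n" by (rule R.genideal_ideal[OF cG'])
    have a: "monomial a \<in> Idl\<^bsub>T n\<^esub> G'"
      using R.genideal_self[OF cG'] ab ne by (auto simp: G'_def)
    obtain b' :: monom where b': "monomial b = (monomial b' :: 'k polynomial)" "set_mset b' \<subseteq> {1..n}"
      using ab(2) sub by (auto simp: monomials_def)
    then have "set_mset (b - a) \<subseteq> {1..n}" by (auto dest: in_diffD)
    then have "monomial (b - a) \<in> (carrier (T n) :: 'k polynomial set)"
      by (simp add: T_def monomial_def)
    then have "monomial (b - a) \<otimes>\<^bsub>T n\<^esub> monomial a \<in> Idl\<^bsub>T n\<^esub> G'"
      using a by (rule Id.I_l_closed[rotated])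
    then have "monomial b \<in> Idl\<^bsub>T n\<^esub> G'" using ab(3) by (simp add: T_def monomial_mult)
    moreover have "G' \<subseteq> Idl\<^bsub>T n\<^esub> G'" by (rule R.genideal_self[OF cG'])
    ultimately have "G \<subseteq> Idl\<^bsub>T n\<^esub> G'" by (auto simp: G'_def)
    then have "Idl\<^bsub>T n\<^esub> G \<subseteq> Idl\<^bsub>T n\<^esub> G'" by (rule R.genideal_minimal[OF Id.ideal_axioms])
    moreover have "Idl\<^bsub>T n\<^esub> G' \<subseteq> Idl\<^bsub>T n\<^esub> G"
      by (rule R.genideal_minimal[OF R.genideal_ideal[OF cG]])
        (use R.genideal_self[OF cG] in \<open>auto simp: G'_def\<close>)
    ultimately have "Idl\<^bsub>T n\<^esub> G' = I" using I by auto
    moreover have "G' \<subset> G" using ab by (auto simp: G'_def)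
    ultimately show False using G by (auto simp: minimal_monomial_generators_def)
  qed
  have "A \<subseteq> B" if A: "minimal_monomial_generators n I A"
    and B: "minimal_monomial_generators n I B" for A B :: "'k polynomial set"
  proof
    fix f assume f: "f \<in> A"
    have sub: "A \<subseteq> monomials n" "B \<subseteq> monomials n"
      and I: "Idl\<^bsub>T n\<^esub> A = I" "Idl\<^bsub>T n\<^esub> B = I"
      using A B by (auto simp: minimal_monomial_generators_def)
    obtain a where a: "f = monomial a" using f sub by (auto simp: monomials_def)
    have "f \<in> Idl\<^bsub>T n\<^esub> B" using f I R.genideal_self[OF carr[OF sub(1)]] by auto
    then obtain b where b: "monomial b \<in> B" "b \<subseteq># a"
      using monomial_in_Idl_imp_dvd[OF sub(2)] a by blast
    have "monomial b \<in> Idl\<^bsub>T n\<^esub> A" using b I R.genideal_self[OF carr[OF sub(2)]] by auto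
    then obtain c where c: "monomial c \<in> A" "c \<subseteq># b"
      using monomial_in_Idl_imp_dvd[OF sub(1)] by blast
    have "c = a" using anti[OF A c(1)] f a c(2) b(2) by (meson subset_mset.order_trans)
    then have "b = a" using b c by (simp add: subset_mset.antisym)
    then show "f \<in> B" using a b by simp
  qed
  then show ?thesis using G H by blast
qed

lemma min_gens_eqI: "minimal_monomial_generators n I G \<Longrightarrow> min_gens n I = G"
  unfolding min_gens_def
  by (rule the_equality) (auto dest: minimal_monomial_generators_unique)

end

theory Submission
  imports Defs
begin

text \<open>
  Write \<open>w\<close> as \<open>x\<^bsub>i(0)\<^esub> \<cdots> x\<^bsub>i(e-1)\<^esub>\<close> with nondecreasing indices. Then \<open>(\<sigma> ^^ n) w\<close> is the product
  of the variables with index \<open>k * n + i(k)\<close>, \<open>k < e\<close>, and the polarization of \<open>w\<close> is the product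
  of those with index \<open>k * n + j\<close>, \<open>k <\<close> exponent of \<open>x\<^sub>j\<close>. A permutation that preserves residues
  modulo \<open>n\<close> acts separately on each class \<open>j\<close>, that is, on the numbers \<open>k\<close>. Smooth spreadability
  therefore splits into one condition per variable: some injective \<open>f\<close> carries the set of positions
  of \<open>j\<close> in the sorted word of \<open>w\<close>, called \<open>places j w\<close>, onto \<open>{..<count w j}\<close>, simultaneously for
  all \<open>w\<close> in the set. This is the predicate \<open>levelled\<close>, and \<open>smoothly_spreadable_iff_levelled\<close> is the
  equivalence. The map \<open>f\<close> is only prescribed on positions that occur, and such a partial injection
  always extends to a permutation of \<open>{..<d}\<close>. Hence the condition does not mention \<open>d\<close>, and it is
  inherited by subsets with any degree bound that fits them (\<open>smoothly_spreadable_subset\<close>).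

  Now let every \<open>a\<close> in \<open>U\<close> have degree \<open>d\<close> and involve only variables up to \<open>n\<close>, and every \<open>b\<close> in
  \<open>V\<close> only variables beyond \<open>n\<close>. The sorted word of \<open>a b\<close> is that of \<open>a\<close> followed by that of \<open>b\<close>.
  For \<open>j \<le> n\<close> the positions and exponent of \<open>j\<close> in \<open>a b\<close> are those in \<open>a\<close>, so the map for \<open>U\<close> still
  works. For \<open>j > n\<close> the positions are those in \<open>b\<close>, all shifted by the same amount \<open>d\<close>, so the map
  for \<open>V\<close> works after undoing the shift (\<open>levelled_product\<close>). This is where it matters that all
  elements of \<open>U\<close> have the same degree.

  For the ideals, membership in a monomial ideal is tested monomial by monomial
  (\<open>Idl_monomials_eq\<close>), and a monomial divisible by \<open>a\<close> and by \<open>b\<close> without common variables is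
  divisible by \<open>a b\<close>. So product and intersection both equal the ideal generated by the products
  (\<open>separated_monomial_ideals_product\<close>). Its minimal generators form a subset of the set of products,
  possibly of smaller maximal degree, and the heredity noted above applies
  (\<open>smoothly_spreadable_ideal_Idl\<close>).
\<close>

section \<open>Permuting the variables\<close>

lemma poly_mapping_additive_induct [case_names zero single add]:
  assumes "P 0" "\<And>a b. P (Poly_Mapping.single a b)" "\<And>f g. P f \<Longrightarrow> P g \<Longrightarrow> P (f + g)"
  shows "P (f :: 'a \<Rightarrow>\<^sub>0 'b::comm_monoid_add)"
proof (induction f rule: update_induct)
  case const
  then show ?case by (rule assms(1))
next
  case (update f a b)
  then have "Poly_Mapping.update a b f = Poly_Mapping.single a b + f"
    by (intro poly_mapping_eqI)
      (auto simp: lookup_update lookup_add lookup_single in_keys_iff when_def)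
  then show ?case using assms(2,3) update by metis
qed

text \<open>
  The inverse permutation appears because \<open>map_key\<close> precomposes the coefficient function: the
  coefficient of \<open>w\<close> in the image is the coefficient of the monomial that is renamed to \<open>w\<close>.
\<close>

definition rename :: "(nat \<Rightarrow> nat) \<Rightarrow> 'k::field polynomial \<Rightarrow> 'k polynomial" where
  "rename \<tau> f = Poly_Mapping.map_key (image_mset (inv_into UNIV \<tau>)) f"

context
  fixes \<tau> :: "nat \<Rightarrow> nat" and N :: nat
  assumes \<tau>: "\<tau> permutes {1..N}"
begin

lemma inj_image_mset_inv: "inj (image_mset (inv_into UNIV \<tau>))"
  using \<tau> by (intro multiset.inj_map permutes_inj permutes_inv)

lemma rename_add: "rename \<tau> (f + g) = rename \<tau> f + rename \<tau> g"
  unfolding rename_def by (rule map_key_plus[OF inj_image_mset_inv])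

lemma rename_zero: "rename \<tau> 0 = 0"
  unfolding rename_def by (rule map_key_zero[OF inj_image_mset_inv])

lemma rename_single: "rename \<tau> (Poly_Mapping.single w c) = Poly_Mapping.single (image_mset \<tau> w) c"
proof -
  have "image_mset (inv_into UNIV \<tau>) (image_mset \<tau> w) = w"
    using \<tau> by (simp add: image_mset.compositionality comp_def permutes_inverses)
  then show ?thesis
    unfolding rename_def using map_key_single[OF inj_image_mset_inv, of "image_mset \<tau> w" c] by simp
qed

lemma rename_mult: "rename \<tau> (f * g) = rename \<tau> f * rename \<tau> g"
proof (induction f rule: poly_mapping_additive_induct)
  case (single a b)
  show ?case
    by (induction g rule: poly_mapping_additive_induct)
      (simp_all add: rename_zero rename_add rename_single mult_single distrib_left)
qed (simp_all add: rename_zero rename_add distrib_right)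

lemma rename_carrier: "f \<in> carrier (T N) \<Longrightarrow> rename \<tau> f \<in> carrier (T N)"
proof -
  assume f: "f \<in> carrier (T N)"
  have "set_mset w \<subseteq> {1..N}" if "image_mset (inv_into UNIV \<tau>) w \<in> Poly_Mapping.keys f" for w
  proof -
    have "inv_into UNIV \<tau> ` set_mset w \<subseteq> {1..N}"
      using f that by (fastforce simp: T_def simp del: atLeastAtMost_iff)
    then show ?thesis using permutes_in_image[OF permutes_inv[OF \<tau>]] by blast
  qed
  then show ?thesis by (simp add: T_def rename_def keys_map_key[OF inj_image_mset_inv])
qed

end

lemma rename_inverse:
  assumes "\<tau> permutes {1..N}"
  shows "rename (inv_into UNIV \<tau>) (rename \<tau> f) = f"
  using assms permutes_inv[OF assms]
  by (induction f rule: poly_mapping_additive_induct)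
    (simp_all add: rename_zero rename_add rename_single image_mset.compositionality
      comp_def permutes_inverses)

lemma rename_alg_iso:
  assumes \<tau>: "\<tau> permutes {1..N}"
  shows "rename \<tau> \<in> alg_iso N N"
proof -
  have "rename \<tau> \<in> ring_hom (T N) (T N)"
    using rename_carrier[OF \<tau>] rename_mult[OF \<tau>] rename_add[OF \<tau>] rename_single[OF \<tau>, of "{#}" 1]
    by (intro ring_hom_memI) (auto simp: T_def zero_multiset_def[symmetric] simp flip: single_one)
  moreover have "bij_betw (rename \<tau>) (carrier (T N)) (carrier (T N))"
  proof (rule bij_betw_byWitness[where f' = "rename (inv_into UNIV \<tau>)"])
    show "\<forall>f\<in>carrier (T N). rename (inv_into UNIV \<tau>) (rename \<tau> f) = f"
      using rename_inverse[OF \<tau>] by blast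
    show "\<forall>f\<in>carrier (T N). rename \<tau> (rename (inv_into UNIV \<tau>) f) = f"
      using rename_inverse[OF permutes_inv[OF \<tau>]] unfolding permutes_inv_inv[OF \<tau>] by blast
  qed (use rename_carrier[OF \<tau>] rename_carrier[OF permutes_inv[OF \<tau>]] in auto)
  ultimately show ?thesis
    by (simp add: alg_iso_def ring_iso_def const_def rename_single[OF \<tau>])
qed

text \<open>
  Every isomorphism that renames the variables has the same effect on monomials, so the isomorphism
  can be eliminated from the definition of smooth spreadability in favour of the permutation.
\<close>

lemma alg_iso_monomial:
  fixes \<Phi> :: "'k::field polynomial \<Rightarrow> 'k polynomial"
  assumes \<Phi>: "\<Phi> \<in> alg_iso N N" and var: "\<And>j. j \<in> {1..N} \<Longrightarrow> \<Phi> (var j) = var (\<tau> j)"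
    and w: "set_mset w \<subseteq> {1..N}"
  shows "\<Phi> (monomial w) = monomial (image_mset \<tau> w)"
  using w
proof (induction w)
  case empty
  have "\<Phi> (const 1) = const 1" using \<Phi> by (simp add: alg_iso_def)
  then show ?case by (simp add: const_def monomial_def)
next
  case (add j w)
  have carr: "monomial v \<in> carrier (T N :: 'k polynomial ring)" if "set_mset v \<subseteq> {1..N}" for v
    using that by (simp add: T_def monomial_def)
  have hom: "\<Phi> \<in> ring_hom (T N) (T N)" using \<Phi> by (simp add: alg_iso_def ring_iso_def)
  have "monomial (add_mset j w) = (var j :: 'k polynomial) * monomial w"
    by (simp add: var_def monomial_mult)
  then have "\<Phi> (monomial (add_mset j w)) = \<Phi> (var j) * \<Phi> (monomial w)"
    using ring_hom_mult[OF hom carr[of "{#j#}"] carr[of w]] add.prems by (simp add: T_def var_def)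
  then show ?case using add var[of j] by (simp add: var_def monomial_mult)
qed

section \<open>Smooth spreadability one variable at a time\<close>

lemma length_sorted_list_of_multiset: "length (sorted_list_of_multiset u) = size u"
  by (metis mset_sorted_list_of_multiset size_mset)

text \<open>
  One application of \<open>\<sigma>\<close> keeps the word sorted, so the next application shifts each letter according to
  its original position; the shifts add up.
\<close>

lemma spread_eq_mset:
  "(\<sigma> ^^ t) u = mset (map (\<lambda>k. k * t + sorted_list_of_multiset u ! k) [0..<size u])"
proof (induction t)
  case 0
  show ?case by (simp add: map_nth flip: length_sorted_list_of_multiset)
next
  case (Suc t)
  define L where "L = map (\<lambda>k. k * t + sorted_list_of_multiset u ! k) [0..<size u]"
  have "sorted L"
    unfolding L_def sorted_iff_nth_mono
    using sorted_nth_mono[OF sorted_sorted_list_of_multiset[of u]]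
    by (auto simp: length_sorted_list_of_multiset intro!: add_mono)
  moreover have "length L = size u" by (simp add: L_def)
  ultimately have "\<sigma> (mset L) = mset (map2 (+) L [0..<size u])"
    by (simp add: \<sigma>_def sorted_sort_id)
  also have "map2 (+) L [0..<size u] =
      map (\<lambda>k. k * Suc t + sorted_list_of_multiset u ! k) [0..<size u]"
    by (rule nth_equalityI) (auto simp: L_def)
  finally show ?case using Suc by (simp add: L_def)
qed

definition places :: "nat \<Rightarrow> monom \<Rightarrow> nat set" where
  "places j u = {k. k < size u \<and> sorted_list_of_multiset u ! k = j}"

text \<open>
  The numbers \<open>1, \<dots>, n * d\<close> arranged in a grid: column \<open>j \<in> {1..n}\<close> is a residue class modulo \<open>n\<close>,
  and the rows are numbered by \<open>k < d\<close>.
\<close>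

definition cell :: "nat \<Rightarrow> nat \<times> nat \<Rightarrow> nat" where
  "cell n = (\<lambda>(j, k). k * n + j)"

lemma cell_inj:
  assumes "cell n (j, k) = cell n (j', k')" "j \<in> {1..n}" "j' \<in> {1..n}"
  shows "j = j' \<and> k = k'"
proof -
  have *: "(k * n + j - 1) div n = k \<and> (k * n + j - 1) mod n = j - 1" if "j \<in> {1..n}" for j k
  proof -
    have "k * n + j - 1 = (j - 1) + k * n" "j - 1 < n" using that by auto
    then show ?thesis by simp
  qed
  have "j - 1 = j' - 1" "k = k'"
    using *[of j k] *[of j' k'] assms by (simp_all add: cell_def)
  then show ?thesis using assms by auto
qed

lemma inj_on_cell: "inj_on (cell n) (SIGMA j:{1..n}. A j)"
proof (rule inj_onI)
  fix x y assume "x \<in> (SIGMA j:{1..n}. A j)" "y \<in> (SIGMA j:{1..n}. A j)" "cell n x = cell n y"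
  then show "x = y" using cell_inj[of n "fst x" "snd x" "fst y" "snd y"] by (auto simp: prod_eq_iff)
qed

lemma cell_bounds:
  assumes "j \<in> {1..n}" "k < d"
  shows "cell n (j, k) \<in> {1..n * d}"
proof -
  have "k * n + j \<le> Suc k * n" using assms by simp
  also have "\<dots> \<le> d * n" using assms by (intro mult_le_mono1) auto
  finally show ?thesis using assms by (simp add: cell_def mult.commute)
qed

lemma cell_cases:
  assumes "x \<in> {1..n * d}"
  obtains j k where "j \<in> {1..n}" "k < d" "x = cell n (j, k)"
proof
  have n: "0 < n" using assms by (cases n) auto
  show "(x - 1) mod n + 1 \<in> {1..n}" using n by (simp add: Suc_leI)
  have "x - 1 < n * d" using assms by auto
  then show "(x - 1) div n < d" by (simp add: less_mult_imp_div_less mult.commute)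
  have "(x - 1) div n * n + (x - 1) mod n = x - 1" by simp
  then show "x = cell n ((x - 1) mod n + 1, (x - 1) div n)" using assms by (auto simp: cell_def)
qed

lemma finite_places [simp]: "finite (places j u)"
  by (simp add: places_def)

text \<open>
  In the grid, the spread monomial and the polarization are squarefree and have the same number of
  cells in each column; they differ in which rows are occupied.
\<close>

lemma spread_eq:
  assumes u: "set_mset u \<subseteq> {1..n}"
  shows "(\<sigma> ^^ n) u = mset_set (cell n ` (SIGMA j:{1..n}. places j u))"
proof -
  define h where "h k = (sorted_list_of_multiset u ! k, k)" for k
  have range: "sorted_list_of_multiset u ! k \<in> {1..n}" if "k < size u" for k
  proof -
    have "sorted_list_of_multiset u ! k \<in> set (sorted_list_of_multiset u)"
      using that by (intro nth_mem) (simp add: length_sorted_list_of_multiset)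
    then show ?thesis using u by auto
  qed
  have img: "h ` {..<size u} = (SIGMA j:{1..n}. places j u)"
    using range by (auto simp: h_def places_def)
  have "(\<sigma> ^^ n) u = image_mset (cell n) (image_mset h (mset_set {..<size u}))"
    by (simp add: spread_eq_mset image_mset.compositionality h_def cell_def comp_def
        lessThan_atLeast0 mset_map)
  also have "image_mset h (mset_set {..<size u}) = mset_set (h ` {..<size u})"
    by (rule image_mset_mset_set) (auto simp: h_def inj_on_def)
  finally show ?thesis unfolding img image_mset_mset_set[OF inj_on_cell] .
qed

lemma polarization_eq:
  "polarization n u = mset_set (cell n ` (SIGMA j:{1..n}. {..<count u j}))"
proof -
  have "polarization n u = (\<Sum>x\<in>(SIGMA j:{1..n}. {..<count u j}). {#cell n x#})"
    unfolding polarization_def by (subst sum.Sigma) (auto simp: cell_def case_prod_unfold)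
  also have "\<dots> = (\<Sum>y\<in>cell n ` (SIGMA j:{1..n}. {..<count u j}). {#y#})"
    by (subst sum.reindex[OF inj_on_cell]) auto
  finally show ?thesis by simp
qed

text \<open>
  The row permutation of a single column \<open>j\<close>, restricted to the rows that are occupied by the spread of
  some element of \<open>U\<close>. It pushes each of these column segments down to the bottom of the column.
\<close>

definition levelled :: "nat \<Rightarrow> monom set \<Rightarrow> bool" where
  "levelled j U \<longleftrightarrow>
     (\<exists>f. inj_on f (\<Union>u\<in>U. places j u) \<and> (\<forall>u\<in>U. f ` places j u = {..<count u j}))"

lemma levelledI:
  "inj_on f (\<Union>u\<in>U. places j u) \<Longrightarrow> (\<And>u. u \<in> U \<Longrightarrow> f ` places j u = {..<count u j}) \<Longrightarrow> levelled j U"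
  unfolding levelled_def by (intro exI conjI ballI)

lemma levelledE:
  assumes "levelled j U"
  obtains f where "inj_on f (\<Union>u\<in>U. places j u)" "\<And>u. u \<in> U \<Longrightarrow> f ` places j u = {..<count u j}"
  using assms unfolding levelled_def by (elim exE conjE) (rule that, assumption, erule (1) bspec)

lemma levelled_mono:
  assumes "levelled j U" "V \<subseteq> U"
  shows "levelled j V"
proof -
  obtain f where f: "inj_on f (\<Union>u\<in>U. places j u)" "\<And>u. u \<in> U \<Longrightarrow> f ` places j u = {..<count u j}"
    using assms(1) by (rule levelledE) blast
  have "inj_on f (\<Union>u\<in>V. places j u)"
    using f(1) by (rule inj_on_subset) (use assms(2) in blast)
  then show ?thesis by (rule levelledI) (use f(2) assms(2) in auto)
qed

lemma inj_on_extends_to_permutes: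
  assumes "finite S" "A \<subseteq> S" "f ` A \<subseteq> S" "inj_on f A"
  shows "\<exists>\<pi>. \<pi> permutes S \<and> (\<forall>a\<in>A. \<pi> a = f a)"
proof -
  have "card (S - A) = card (S - f ` A)"
    using assms by (simp add: card_Diff_subset finite_subset card_image)
  then obtain g where g: "bij_betw g (S - A) (S - f ` A)"
    using assms finite_same_card_bij[of "S - A" "S - f ` A"] by auto
  define \<pi> where "\<pi> x = (if x \<in> A then f x else if x \<in> S then g x else x)" for x
  have "bij_betw \<pi> A (f ` A)"
    using assms(4) by (auto simp: \<pi>_def bij_betw_def inj_on_def)
  moreover have "bij_betw \<pi> (S - A) (S - f ` A)"
    using g by (subst bij_betw_cong[where g = g]) (auto simp: \<pi>_def)
  ultimately have "bij_betw \<pi> (A \<union> (S - A)) (f ` A \<union> (S - f ` A))"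
    by (rule bij_betw_combine) auto
  moreover have "A \<union> (S - A) = S" "f ` A \<union> (S - f ` A) = S" using assms by auto
  ultimately have "\<pi> permutes S"
    using assms(2) by (intro bij_imp_permutes) (auto simp: \<pi>_def)
  then show ?thesis by (intro exI[of _ \<pi>]) (auto simp: \<pi>_def)
qed

lemma image_spread_eq_polarization_iff:
  assumes "inj \<tau>" "set_mset u \<subseteq> {1..n}"
  shows "image_mset \<tau> ((\<sigma> ^^ n) u) = polarization n u \<longleftrightarrow>
    \<tau> ` cell n ` (SIGMA j:{1..n}. places j u) = cell n ` (SIGMA j:{1..n}. {..<count u j})"
  using assms
  by (simp add: spread_eq polarization_eq image_mset_mset_set inj_on_subset[OF _ subset_UNIV])

lemma spread_bounds:
  assumes "set_mset u \<subseteq> {1..n}" "size u \<le> d"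
  shows "set_mset ((\<sigma> ^^ n) u) \<subseteq> {1..n * d}"
  using assms cell_bounds[of _ n _ d] by (fastforce simp: spread_eq places_def)

text \<open>
  A permutation that preserves residues maps each column of the grid to itself, so it is a family of row
  permutations, one for each column; comparing the column \<open>j\<close> of the two squarefree monomials gives the
  condition on \<open>j\<close>. Conversely, the partial injections on the columns are extended to permutations of
  the rows and assembled.
\<close>

lemma residue_permutation_iff_levelled:
  assumes U: "\<And>u. u \<in> U \<Longrightarrow> set_mset u \<subseteq> {1..n} \<and> size u \<le> d"
  shows "(\<exists>\<tau>. \<tau> permutes {1..n * d} \<and> (\<forall>j\<in>{1..n * d}. [\<tau> j = j] (mod n)) \<and>
           (\<forall>u\<in>U. image_mset \<tau> ((\<sigma> ^^ n) u) = polarization n u))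
         \<longleftrightarrow> (\<forall>j\<in>{1..n}. levelled j U)" (is "?L \<longleftrightarrow> ?R")
proof -
  have places_less: "k < d" if "k \<in> places j u" "u \<in> U" for j k u
    using U that by (force simp: places_def)
  show ?thesis
  proof
    assume ?L
    then obtain \<tau> where \<tau>: "\<tau> permutes {1..n * d}" "\<And>j. j \<in> {1..n * d} \<Longrightarrow> [\<tau> j = j] (mod n)"
      "\<And>u. u \<in> U \<Longrightarrow> image_mset \<tau> ((\<sigma> ^^ n) u) = polarization n u"
      by blast
    \<comment> \<open>The row to which the cell in column \<open>j\<close> and row \<open>k\<close> is sent.\<close>
    define g where "g j k = (\<tau> (cell n (j, k)) - j) div n" for j k
    have \<tau>_cell: "\<tau> (cell n (j, k)) = cell n (j, g j k)" if jk: "j \<in> {1..n}" "k < d" for j k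
    proof -
      have x: "cell n (j, k) \<in> {1..n * d}" using jk by (rule cell_bounds)
      then have "\<tau> (cell n (j, k)) \<in> {1..n * d}" using permutes_in_image[OF \<tau>(1)] by blast
      then obtain j' k' where c: "j' \<in> {1..n}" "\<tau> (cell n (j, k)) = cell n (j', k')"
        by (rule cell_cases)
      have "[cell n (j', k') = cell n (j, k)] (mod n)" using \<tau>(2)[OF x] c by simp
      then have "[j' = j] (mod n)" by (simp add: cell_def cong_def)
      moreover have "[j' - 1 + 1 = j - 1 + 1] (mod n)" using calculation c jk by simp
      \<comment> \<open>Columns run from \<open>1\<close> to \<open>n\<close>; subtracting \<open>1\<close> turns them into reduced residues.\<close>
      ultimately have "[j' - 1 = j - 1] (mod n)" using cong_add_rcancel_nat by blast
      then have "j' - 1 = j - 1" using c jk by (intro cong_less_modulus_unique_nat) auto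
      then have "j' = j" using c jk by auto
      then show ?thesis using c jk by (simp add: g_def cell_def)
    qed
    show ?R
    proof
      fix j assume j: "j \<in> {1..n}"
      have "inj_on (g j) (\<Union>u\<in>U. places j u)"
      proof (rule inj_onI)
        fix k k' assume k: "k \<in> (\<Union>u\<in>U. places j u)" "k' \<in> (\<Union>u\<in>U. places j u)" "g j k = g j k'"
        then have "\<tau> (cell n (j, k)) = \<tau> (cell n (j, k'))"
          using \<tau>_cell[OF j] places_less by auto
        then have "cell n (j, k) = cell n (j, k')"
          using permutes_inj[OF \<tau>(1)] by (simp add: inj_eq)
        then show "k = k'" using cell_inj j by blast
      qed
      moreover have "g j ` places j u = {..<count u j}" if u: "u \<in> U" for u
      proof -
        have eq: "\<tau> ` cell n ` (SIGMA j:{1..n}. places j u) = cell n ` (SIGMA j:{1..n}. {..<count u j})"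
          using \<tau>(3)[OF u]
            image_spread_eq_polarization_iff[OF permutes_inj[OF \<tau>(1)] conjunct1[OF U[OF u]]]
          by (rule iffD1[rotated])
        have "(\<lambda>(j, k). (j, g j k)) ` (SIGMA j:{1..n}. places j u) = (SIGMA j:{1..n}. {..<count u j})"
        proof -
          have "\<tau> ` cell n ` (SIGMA j:{1..n}. places j u) =
              cell n ` (\<lambda>(j, k). (j, g j k)) ` (SIGMA j:{1..n}. places j u)"
            unfolding image_image using \<tau>_cell places_less[OF _ u] by (intro image_cong) auto
          moreover have "inj_on (cell n) (SIGMA j:{1..n}. UNIV)" by (rule inj_on_cell)
          ultimately show ?thesis
            using eq by (intro inj_on_image_eq_iff[of "cell n" "{1..n} \<times> UNIV", THEN iffD1])
              (auto simp del: atLeastAtMost_iff)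
        qed
        \<comment> \<open>The fibre over \<open>j\<close> isolates one column.\<close>
        from arg_cong[OF this, of "\<lambda>S. S `` {j}"] show ?thesis
          using j by (auto simp del: atLeastAtMost_iff)
      qed
      ultimately show "levelled j U" by (rule levelledI)
    qed
  next
    assume ?R
    have "\<exists>\<pi>. \<pi> permutes {..<d} \<and> (\<forall>u\<in>U. \<pi> ` places j u = {..<count u j})"
      if j: "j \<in> {1..n}" for j
    proof -
      obtain f where f: "inj_on f (\<Union>u\<in>U. places j u)"
        "\<And>u. u \<in> U \<Longrightarrow> f ` places j u = {..<count u j}"
        using bspec[OF \<open>?R\<close> j] by (rule levelledE) blast
      have "f ` places j u \<subseteq> {..<d}" if "u \<in> U" for u
        unfolding f(2)[OF that] using U[OF that] count_le_size[of u j] by auto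
      then have img: "f ` (\<Union>u\<in>U. places j u) \<subseteq> {..<d}" unfolding image_UN by (rule UN_least)
      have dom: "(\<Union>u\<in>U. places j u) \<subseteq> {..<d}" using places_less by auto
      obtain \<pi> where \<pi>: "\<pi> permutes {..<d}" "\<forall>a\<in>(\<Union>u\<in>U. places j u). \<pi> a = f a"
        using inj_on_extends_to_permutes[OF finite_lessThan dom img f(1)] by (elim exE conjE)
      have "\<pi> ` places j u = f ` places j u" if "u \<in> U" for u
        using \<pi>(2) that by (intro image_cong) auto
      then have "\<forall>u\<in>U. \<pi> ` places j u = {..<count u j}" using f(2) by simp
      with \<pi>(1) show ?thesis by blast
    qed
    then obtain \<pi> where \<pi>: "\<And>j. j \<in> {1..n} \<Longrightarrow> \<pi> j permutes {..<d}"
      "\<And>j u. j \<in> {1..n} \<Longrightarrow> u \<in> U \<Longrightarrow> \<pi> j ` places j u = {..<count u j}"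
      by metis
    define p where "p = (\<lambda>(j, k). (j :: nat, \<pi> j k :: nat))"
    define \<tau> where "\<tau> x = (if x \<in> {1..n * d}
      then cell n (p (inv_into ({1..n} \<times> UNIV) (cell n) x)) else x)" for x
    have \<tau>_cell: "\<tau> (cell n (j, k)) = cell n (j, \<pi> j k)" if "j \<in> {1..n}" "k < d" for j k
      using that cell_bounds[of j n k d] inv_into_f_f[OF inj_on_cell[of n "\<lambda>_. UNIV"], of "(j, k)"]
      by (simp add: \<tau>_def p_def)
    have \<pi>_less: "\<pi> j k < d \<longleftrightarrow> k < d" if "j \<in> {1..n}" for j k
      using permutes_in_image[OF \<pi>(1)[OF that]] by simp
    have "inj_on \<tau> {1..n * d}"
    proof (rule inj_onI)
      fix x y assume x: "x \<in> {1..n * d}" and y: "y \<in> {1..n * d}" and eq: "\<tau> x = \<tau> y"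
      obtain j k where jk: "j \<in> {1..n}" "k < d" "x = cell n (j, k)" using x by (rule cell_cases)
      obtain j' k' where jk': "j' \<in> {1..n}" "k' < d" "y = cell n (j', k')" using y by (rule cell_cases)
      have "cell n (j, \<pi> j k) = cell n (j', \<pi> j' k')" using eq jk jk' \<tau>_cell by simp
      then have "j = j' \<and> \<pi> j k = \<pi> j' k'" using cell_inj jk jk' by blast
      then show "x = y" using permutes_inj[OF \<pi>(1)[OF jk(1)]] jk jk' by (auto simp: inj_eq)
    qed
    moreover have "\<tau> ` {1..n * d} \<subseteq> {1..n * d}"
    proof
      fix y assume "y \<in> \<tau> ` {1..n * d}"
      then obtain x where "x \<in> {1..n * d}" "y = \<tau> x" by blast
      then show "y \<in> {1..n * d}"
        by (elim cell_cases) (use \<tau>_cell \<pi>_less cell_bounds in metis)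
    qed
    ultimately have "bij_betw \<tau> {1..n * d} {1..n * d}"
      by (simp add: bij_betw_def endo_inj_surj)
    then have perm: "\<tau> permutes {1..n * d}"
      by (rule bij_imp_permutes) (auto simp: \<tau>_def)
    moreover have "[\<tau> x = x] (mod n)" if "x \<in> {1..n * d}" for x
      using that by (elim cell_cases) (use \<tau>_cell in \<open>simp add: cell_def cong_def\<close>)
    moreover have "image_mset \<tau> ((\<sigma> ^^ n) u) = polarization n u" if u: "u \<in> U" for u
    proof -
      have "\<tau> ` cell n ` (SIGMA j:{1..n}. places j u) = cell n ` p ` (SIGMA j:{1..n}. places j u)"
        unfolding image_image using \<tau>_cell places_less[OF _ u] by (intro image_cong) (auto simp: p_def)
      also have "p ` (SIGMA j:{1..n}. places j u) = (SIGMA j:{1..n}. \<pi> j ` places j u)"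
        by (force simp: p_def)
      also have "\<dots> = (SIGMA j:{1..n}. {..<count u j})"
        using \<pi>(2)[OF _ u] by (intro Sigma_cong) auto
      finally show ?thesis
        using image_spread_eq_polarization_iff[OF permutes_inj[OF perm] conjunct1[OF U[OF u]]]
        by (rule iffD2[rotated])
    qed
    ultimately show ?L by blast
  qed
qed

lemma smoothly_spreadable_iff_levelled:
  fixes U :: "monom set"
  shows "smoothly_spreadable n d (monomial ` U :: 'k::field polynomial set) \<longleftrightarrow>
     d > 0 \<and> finite U \<and> U \<noteq> {} \<and> (\<forall>u\<in>U. set_mset u \<subseteq> {1..n} \<and> size u \<le> d) \<and>
     (\<forall>j\<in>{1..n}. levelled j U)"
proof -
  let ?M = "monomial ` U :: 'k polynomial set"
  have mem: "monomial u \<in> ?M \<longleftrightarrow> u \<in> U" for u by auto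
  have fin: "finite ?M \<longleftrightarrow> finite U" by (rule finite_image_iff) (auto simp: inj_on_def)
  have "monomial u \<in> (monomials n :: 'k polynomial set) \<longleftrightarrow> set_mset u \<subseteq> {1..n}" for u
    by (auto simp: monomials_def simp del: atLeastAtMost_iff)
  then have sub: "?M \<subseteq> monomials n \<longleftrightarrow> (\<forall>u\<in>U. set_mset u \<subseteq> {1..n})"
    by (simp add: image_subset_iff)
  let ?P = "\<lambda>\<tau>. \<tau> permutes {1..n * d} \<and> (\<forall>j\<in>{1..n * d}. [\<tau> j = j] (mod n))"
  have iso: "(\<exists>\<Phi> :: 'k polynomial \<Rightarrow> 'k polynomial. \<Phi> \<in> alg_iso (n * d) (n * d) \<and>
        (\<forall>j\<in>{1..n * d}. \<Phi> (var j) = var (\<tau> j)) \<and>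
        (\<forall>u\<in>U. \<Phi> (monomial ((\<sigma> ^^ n) u)) = monomial (polarization n u)))
      \<longleftrightarrow> (\<forall>u\<in>U. image_mset \<tau> ((\<sigma> ^^ n) u) = polarization n u)" (is "?L \<longleftrightarrow> ?R")
    if U: "\<forall>u\<in>U. set_mset u \<subseteq> {1..n} \<and> size u \<le> d" and \<tau>: "\<tau> permutes {1..n * d}" for \<tau>
  proof
    assume ?L
    then obtain \<Phi> :: "'k polynomial \<Rightarrow> 'k polynomial"
      where \<Phi>: "\<Phi> \<in> alg_iso (n * d) (n * d)" "\<And>j. j \<in> {1..n * d} \<Longrightarrow> \<Phi> (var j) = var (\<tau> j)"
        "\<And>u. u \<in> U \<Longrightarrow> \<Phi> (monomial ((\<sigma> ^^ n) u)) = monomial (polarization n u)" by blast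
    show ?R
      using alg_iso_monomial[OF \<Phi>(1,2) spread_bounds] U \<Phi>(3) by (metis monomial_eq_iff)
  next
    assume ?R
    then show ?L
      using rename_alg_iso[OF \<tau>]
      by (intro exI[of _ "rename \<tau>"]) (auto simp: var_def monomial_def rename_single[OF \<tau>])
  qed
  let ?E = "\<exists>\<tau>. ?P \<tau> \<and> (\<exists>\<Phi> :: 'k polynomial \<Rightarrow> 'k polynomial. \<Phi> \<in> alg_iso (n * d) (n * d) \<and>
        (\<forall>j\<in>{1..n * d}. \<Phi> (var j) = var (\<tau> j)) \<and>
        (\<forall>u\<in>U. \<Phi> (monomial ((\<sigma> ^^ n) u)) = monomial (polarization n u)))"
  have unfolded: "smoothly_spreadable n d ?M \<longleftrightarrow>
      d > 0 \<and> finite U \<and> U \<noteq> {} \<and> (\<forall>u\<in>U. set_mset u \<subseteq> {1..n}) \<and> (\<forall>u\<in>U. size u \<le> d) \<and> ?E"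
    unfolding smoothly_spreadable_def fin sub mem by (simp add: Ball_def)
  show ?thesis
  proof (cases "\<forall>u\<in>U. set_mset u \<subseteq> {1..n} \<and> size u \<le> d")
    case True
    have "?E \<longleftrightarrow> (\<exists>\<tau>. ?P \<tau> \<and> (\<forall>u\<in>U. image_mset \<tau> ((\<sigma> ^^ n) u) = polarization n u))"
      using iso[OF True] by (intro ex_cong1 conj_cong refl) blast
    also have "\<dots> \<longleftrightarrow> (\<forall>j\<in>{1..n}. levelled j U)"
      using True by (subst residue_permutation_iff_levelled[symmetric, of U n d])
        (auto simp del: atLeastAtMost_iff)
    finally show ?thesis unfolding unfolded using True by blast
  next
    case False
    then show ?thesis unfolding unfolded by blast
  qed
qed

text \<open>
  The new bound \<open>e\<close> may be smaller than \<open>d\<close>: the row permutations of \<open>{..<d}\<close> need not preserve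
  \<open>{..<e}\<close>, but their restrictions to the occupied rows can be extended afresh.
\<close>

lemma smoothly_spreadable_subset:
  assumes "smoothly_spreadable n d (monomial ` U :: 'k::field polynomial set)"
    and "V \<subseteq> U" "V \<noteq> {}" "e > 0" "\<And>v. v \<in> V \<Longrightarrow> size v \<le> e"
  shows "smoothly_spreadable n e (monomial ` V :: 'k polynomial set)"
  using assms levelled_mono[OF _ assms(2)] unfolding smoothly_spreadable_iff_levelled
  by (blast intro: finite_subset)

section \<open>Products in separated variables\<close>

lemma sorted_list_of_multiset_add_separated:
  assumes "\<And>x y. x \<in># u \<Longrightarrow> y \<in># v \<Longrightarrow> x \<le> (y :: 'a::linorder)"
  shows "sorted_list_of_multiset (u + v) = sorted_list_of_multiset u @ sorted_list_of_multiset v"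
proof -
  have "sorted (sorted_list_of_multiset u @ sorted_list_of_multiset v)"
    using assms by (simp add: sorted_append)
  then show ?thesis
    by (metis mset_append mset_sorted_list_of_multiset sorted_list_of_multiset_mset sorted_sort_id)
qed

lemma places_add_separated:
  assumes sep: "\<And>x y. x \<in># u \<Longrightarrow> y \<in># v \<Longrightarrow> x \<le> y"
  shows "places j (u + v) = places j u \<union> (\<lambda>k. size u + k) ` places j v"
proof -
  have nth: "sorted_list_of_multiset (u + v) ! k =
      (if k < size u then sorted_list_of_multiset u ! k else sorted_list_of_multiset v ! (k - size u))" for k
    by (simp add: sorted_list_of_multiset_add_separated[OF sep] nth_append length_sorted_list_of_multiset)
  show ?thesis
  proof (intro equalityI subsetI)
    fix k assume k: "k \<in> places j (u + v)"
    show "k \<in> places j u \<union> (\<lambda>k. size u + k) ` places j v"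
    proof (cases "k < size u")
      case False
      then have "k - size u \<in> places j v" "k = size u + (k - size u)"
        using k by (auto simp: places_def nth)
      then show ?thesis by blast
    qed (use k in \<open>auto simp: places_def nth\<close>)
  qed (auto simp: places_def nth)
qed

lemma places_notin:
  assumes "j \<notin># u"
  shows "places j u = {}"
proof -
  have "sorted_list_of_multiset u ! k \<in># u" if "k < size u" for k
    using that nth_mem[of k "sorted_list_of_multiset u"] by (simp add: length_sorted_list_of_multiset)
  then show ?thesis using assms by (auto simp: places_def)
qed

text \<open>
  The common degree \<open>d\<close> of the elements of \<open>U\<close> makes the shift of the positions of \<open>j > n\<close> independent
  of the factor from \<open>U\<close>, so that a single map serves all products.
\<close>

lemma levelled_product:
  assumes U: "\<And>u. u \<in> U \<Longrightarrow> set_mset u \<subseteq> {1..n} \<and> size u = d"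
    and V: "\<And>v. v \<in> V \<Longrightarrow> set_mset v \<subseteq> {n + 1..}"
    and "levelled j U" "levelled j V"
  shows "levelled j {u + v | u v. u \<in> U \<and> v \<in> V}"
proof (cases "j \<le> n")
  case True
  have j: "j \<notin># v" if "v \<in> V" for v using V[OF that] True by auto
  have *: "places j (u + v) = places j u \<and> count (u + v) j = count u j" if "u \<in> U" "v \<in> V" for u v
    using places_add_separated[of u v j] U[OF that(1)] V[OF that(2)] places_notin[OF j[OF that(2)]]
      j[OF that(2)] by (force simp: not_in_iff)
  obtain f where f: "inj_on f (\<Union>u\<in>U. places j u)" "\<And>u. u \<in> U \<Longrightarrow> f ` places j u = {..<count u j}"
    using \<open>levelled j U\<close> by (rule levelledE) blast
  have "(\<Union>w\<in>{u + v | u v. u \<in> U \<and> v \<in> V}. places j w) \<subseteq> (\<Union>u\<in>U. places j u)"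
    using * by auto
  with f(1) have "inj_on f (\<Union>w\<in>{u + v | u v. u \<in> U \<and> v \<in> V}. places j w)"
    by (rule inj_on_subset)
  then show ?thesis
  proof (rule levelledI)
    fix w assume "w \<in> {u + v | u v. u \<in> U \<and> v \<in> V}"
    then obtain a b where ab: "w = a + b" "a \<in> U" "b \<in> V" by blast
    then show "f ` places j w = {..<count w j}"
      using *[OF ab(2,3)] f(2)[OF ab(2)] by simp
  qed
next
  case False
  have j: "j \<notin># u" if "u \<in> U" for u using U[OF that] False by auto
  have *: "places j (u + v) = (\<lambda>k. d + k) ` places j v \<and> count (u + v) j = count v j"
    if "u \<in> U" "v \<in> V" for u v
    using places_add_separated[of u v j] U[OF that(1)] V[OF that(2)] places_notin[OF j[OF that(1)]]
      j[OF that(1)] by (force simp: not_in_iff)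
  obtain f where f: "inj_on f (\<Union>v\<in>V. places j v)" "\<And>v. v \<in> V \<Longrightarrow> f ` places j v = {..<count v j}"
    using \<open>levelled j V\<close> by (rule levelledE) blast
  have "inj_on (\<lambda>k. f (k - d)) ((\<lambda>k. d + k) ` (\<Union>v\<in>V. places j v))"
    using f(1) by (auto simp: inj_on_def)
  moreover have "(\<Union>w\<in>{u + v | u v. u \<in> U \<and> v \<in> V}. places j w) \<subseteq> (\<lambda>k. d + k) ` (\<Union>v\<in>V. places j v)"
    unfolding image_UN
  proof (rule UN_least)
    fix w assume "w \<in> {u + v | u v. u \<in> U \<and> v \<in> V}"
    then obtain a b where ab: "w = a + b" "a \<in> U" "b \<in> V" by blast
    then show "places j w \<subseteq> (\<Union>v\<in>V. (\<lambda>k. d + k) ` places j v)"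
      using *[OF ab(2,3)] by blast
  qed
  ultimately have "inj_on (\<lambda>k. f (k - d)) (\<Union>w\<in>{u + v | u v. u \<in> U \<and> v \<in> V}. places j w)"
    by (rule inj_on_subset)
  then show ?thesis
  proof (rule levelledI)
    fix w assume "w \<in> {u + v | u v. u \<in> U \<and> v \<in> V}"
    then obtain a b where ab: "w = a + b" "a \<in> U" "b \<in> V" by blast
    then show "(\<lambda>k. f (k - d)) ` places j w = {..<count w j}"
      using *[OF ab(2,3)] f(2)[OF ab(3)] by (simp add: image_image)
  qed
qed

section \<open>Monomial ideals\<close>

lemma monomial_carrier: "set_mset a \<subseteq> {1..n} \<Longrightarrow> monomial a \<in> carrier (T n :: 'k::field polynomial ring)"
  by (simp add: T_def monomial_def)

text \<open>
  The right-hand side is an ideal because divisibility by an element of \<open>A\<close> is inherited by multiples;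
  conversely, each term of such an \<open>f\<close> is a multiple of some generator.
\<close>

lemma Idl_monomials_eq:
  fixes A :: "monom set"
  assumes A: "\<And>a. a \<in> A \<Longrightarrow> set_mset a \<subseteq> {1..n}"
  shows "Idl\<^bsub>T n\<^esub> (monomial ` A :: 'k::field polynomial set) =
    {f \<in> carrier (T n). \<forall>w\<in>Poly_Mapping.keys f. \<exists>a\<in>A. a \<subseteq># w}" (is "?I = ?J")
proof -
  interpret R: cring "T n :: 'k polynomial ring" by (rule cring_T)
  have carr: "(monomial ` A :: 'k polynomial set) \<subseteq> carrier (T n)"
    using A monomial_carrier by blast
  interpret Id: ideal ?I "T n" by (rule R.genideal_ideal[OF carr])
  have upward: "\<exists>a\<in>A. a \<subseteq># v + w" if "\<exists>a\<in>A. a \<subseteq># w" for v w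
    using that by (meson mset_subset_eq_add_right subset_mset.order_trans)
  have "ideal ?J (T n)"
  proof (rule idealI)
    show "ring (T n :: 'k polynomial ring)" by (rule R.ring_axioms)
    show "subgroup ?J (add_monoid (T n))"
    proof (rule R.add.subgroupI)
      show "?J \<subseteq> carrier (T n)" by auto
      show "?J \<noteq> {}" using R.zero_closed by (auto simp: T_def intro!: exI[of _ 0])
    next
      fix f :: "'k polynomial"
      assume f: "f \<in> ?J"
      then have "- f \<oplus>\<^bsub>T n\<^esub> f = \<zero>\<^bsub>T n\<^esub>" "- f \<in> carrier (T n)" by (simp_all add: T_def)
      then have "\<ominus>\<^bsub>T n\<^esub> f = - f" using f R.minus_equality by blast
      then show "\<ominus>\<^bsub>T n\<^esub> f \<in> ?J" using f by (simp add: T_def)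
    next
      fix f g :: "'k polynomial"
      assume f: "f \<in> ?J" and g: "g \<in> ?J"
      then have "f \<oplus>\<^bsub>T n\<^esub> g \<in> carrier (T n)" by blast
      moreover have "\<forall>w\<in>Poly_Mapping.keys (f + g). \<exists>a\<in>A. a \<subseteq># w"
      proof
        fix w assume "w \<in> Poly_Mapping.keys (f + g)"
        then have "w \<in> Poly_Mapping.keys f \<or> w \<in> Poly_Mapping.keys g" using keys_add[of f g] by blast
        then show "\<exists>a\<in>A. a \<subseteq># w" using f g by auto
      qed
      ultimately show "f \<oplus>\<^bsub>T n\<^esub> g \<in> ?J" by (simp add: T_def)
    qed
    fix f g :: "'k polynomial"
    assume f: "f \<in> ?J" and g: "g \<in> carrier (T n)"
    then have "g \<otimes>\<^bsub>T n\<^esub> f \<in> carrier (T n)" by blast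
    moreover have "\<forall>w\<in>Poly_Mapping.keys (g * f). \<exists>a\<in>A. a \<subseteq># w"
    proof
      fix w assume "w \<in> Poly_Mapping.keys (g * f)"
      then obtain v v' where v: "w = v + v'" "v' \<in> Poly_Mapping.keys f"
        using keys_mult[of g f] by blast
      then show "\<exists>a\<in>A. a \<subseteq># w" using f upward[of v'] by auto
    qed
    ultimately show gf: "g \<otimes>\<^bsub>T n\<^esub> f \<in> ?J" by (simp add: T_def)
    have "f \<otimes>\<^bsub>T n\<^esub> g = g \<otimes>\<^bsub>T n\<^esub> f" by (simp add: T_def mult.commute)
    then show "f \<otimes>\<^bsub>T n\<^esub> g \<in> ?J" using gf by simp
  qed
  moreover have "monomial ` A \<subseteq> ?J" using carr by (auto simp: monomial_def)
  ultimately have "?I \<subseteq> ?J" by (rule R.genideal_minimal)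
  moreover have "f \<in> ?I" if f: "f \<in> ?J" for f
  proof -
    have sums: "(\<Sum>w\<in>W. Poly_Mapping.single w (Poly_Mapping.lookup f w)) \<in> ?I"
      if W: "W \<subseteq> Poly_Mapping.keys f" for W
      using finite_subset[OF W finite_keys] W
    proof (induction W rule: finite_induct)
      case empty
      show ?case using Id.zero_closed by (simp add: T_def)
    next
      case (insert w W)
      obtain a where a: "a \<in> A" "a \<subseteq># w" using insert.prems f by blast
      let ?g = "Poly_Mapping.single (w - a) (Poly_Mapping.lookup f w)"
      have "set_mset w \<subseteq> {1..n}" using insert.prems f by (auto simp: T_def)
      then have "?g \<in> carrier (T n)" by (auto simp: T_def dest: in_diffD split: if_splits)
      moreover have "monomial a \<in> ?I" using R.genideal_self[OF carr] a by blast
      ultimately have "?g \<otimes>\<^bsub>T n\<^esub> monomial a \<in> ?I" by (rule Id.I_l_closed[rotated])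
      then have "Poly_Mapping.single w (Poly_Mapping.lookup f w) \<in> ?I"
        using a by (simp add: T_def monomial_def mult_single)
      from Id.a_closed[OF this insert.IH] show ?case using insert by (simp add: T_def)
    qed
    have "(\<Sum>w\<in>Poly_Mapping.keys f. Poly_Mapping.single w (Poly_Mapping.lookup f w)) = f"
      by (rule poly_mapping_eqI) (simp add: lookup_sum lookup_single when_def in_keys_iff)
    then show ?thesis using sums[OF order_refl] by (rule subst)
  qed
  ultimately show ?thesis by blast
qed

text \<open>
  Proper divisibility of monomials is well-founded, so each element of \<open>A\<close> has a divisor in \<open>B\<close>. No
  element of \<open>B\<close> can be dropped, since no other element of \<open>B\<close> divides it.
\<close>

lemma minimal_monomial_generators_minimal_divisors:
  fixes A :: "monom set"
  assumes A: "\<And>a. a \<in> A \<Longrightarrow> set_mset a \<subseteq> {1..n}"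
  defines "B \<equiv> {b \<in> A. \<forall>a\<in>A. a \<subseteq># b \<longrightarrow> a = b}"
  shows "minimal_monomial_generators n (Idl\<^bsub>T n\<^esub> (monomial ` A)) (monomial ` B :: 'k::field polynomial set)"
proof -
  have B: "set_mset b \<subseteq> {1..n}" if "b \<in> B" for b using that A by (auto simp: B_def)
  have "\<exists>b\<in>B. b \<subseteq># a" if "a \<in> A" for a
    using that
  proof (induction a rule: wfp_induct[OF wfp_subset_mset])
    case (1 a)
    show ?case
    proof (cases "a \<in> B")
      case False
      then obtain c where "c \<in> A" "c \<subset># a" using 1 by (auto simp: B_def subset_mset.less_le)
      then show ?thesis using 1 by (meson subset_mset.less_imp_le subset_mset.order_trans)
    qed auto
  qed
  then have "(\<exists>b\<in>B. b \<subseteq># w) \<longleftrightarrow> (\<exists>a\<in>A. a \<subseteq># w)" for w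
    by (metis (no_types, lifting) B_def mem_Collect_eq subset_mset.order_trans)
  then have eq: "Idl\<^bsub>T n\<^esub> (monomial ` B :: 'k polynomial set) = Idl\<^bsub>T n\<^esub> (monomial ` A)"
    using A B by (simp add: Idl_monomials_eq)
  have "Idl\<^bsub>T n\<^esub> H \<noteq> Idl\<^bsub>T n\<^esub> (monomial ` A)" if H: "H \<subset> monomial ` B" for H :: "'k polynomial set"
  proof
    assume *: "Idl\<^bsub>T n\<^esub> H = Idl\<^bsub>T n\<^esub> (monomial ` A)"
    obtain b where b: "b \<in> B" "monomial b \<notin> H" using H by blast
    have "monomial b \<in> Idl\<^bsub>T n\<^esub> (monomial ` A :: 'k polynomial set)"
      using A b(1) by (auto simp: Idl_monomials_eq B_def monomial_carrier)  (auto simp: monomial_def)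
    moreover have "H \<subseteq> monomials n" using H B by (auto simp: monomials_def)
    ultimately obtain c where c: "monomial c \<in> H" "c \<subseteq># b"
      using monomial_in_Idl_imp_dvd * by blast
    then have "c = b" using H b(1) by (auto simp: B_def)
    then show False using b c by simp
  qed
  moreover have "monomial ` B \<subseteq> (monomials n :: 'k polynomial set)" using B by (auto simp: monomials_def)
  ultimately show ?thesis using eq by (simp add: minimal_monomial_generators_def)
qed

text \<open>
  The degree bound of the ideal is its own degree, which may be smaller than \<open>d\<close>. It has to be
  positive, which the exclusion of the trivial monomial ensures.
\<close>

lemma smoothly_spreadable_ideal_Idl:
  fixes U :: "monom set"
  assumes U: "smoothly_spreadable n d (monomial ` U :: 'k::field polynomial set)" and "{#} \<notin> U"
  shows "smoothly_spreadable_ideal n (Idl\<^bsub>T n\<^esub> (monomial ` U :: 'k polynomial set))"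
proof -
  let ?I = "Idl\<^bsub>T n\<^esub> (monomial ` U :: 'k polynomial set)"
  define V where "V = {b \<in> U. \<forall>a\<in>U. a \<subseteq># b \<longrightarrow> a = b}"
  have fin: "finite U" "U \<noteq> {}" and sub: "\<And>u. u \<in> U \<Longrightarrow> set_mset u \<subseteq> {1..n}"
    using U by (auto simp: smoothly_spreadable_iff_levelled)
  have gens: "minimal_monomial_generators n ?I (monomial ` V)"
    unfolding V_def using sub by (rule minimal_monomial_generators_minimal_divisors)
  then have G: "min_gens n ?I = monomial ` V" by (rule min_gens_eqI)
  obtain u where "u \<in> U" using fin(2) by blast
  then obtain b where "b \<in> U" "\<And>a. (a, b) \<in> {(a, b). a \<subset># b} \<Longrightarrow> a \<notin> U"
    using wfE_min[OF wf_subset_mset_rel] by metis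
  then have "V \<noteq> {}" by (auto simp: V_def subset_mset.less_le)
  have V: "V \<subseteq> U" "finite V" using fin by (auto simp: V_def)
  have sizes: "{size u | u. monomial u \<in> (monomial ` V :: 'k polynomial set)} = size ` V" by auto
  have deg: "ideal_deg n ?I = Max (size ` V)" unfolding ideal_deg_def G sizes ..
  have le: "size v \<le> ideal_deg n ?I" if "v \<in> V" for v using that V by (simp add: deg)
  obtain v where "v \<in> V" "v \<noteq> {#}" using \<open>V \<noteq> {}\<close> V \<open>{#} \<notin> U\<close> by blast
  then have "0 < ideal_deg n ?I" using le[of v] by (metis gr0I le_zero_eq size_eq_0_iff_empty)
  then have "smoothly_spreadable n (ideal_deg n ?I) (monomial ` V :: 'k polynomial set)"
    using smoothly_spreadable_subset[OF U V(1) \<open>V \<noteq> {}\<close>] le by blast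
  moreover have "monomial_ideal n ?I"
    using gens by (auto simp: monomial_ideal_def minimal_monomial_generators_def)
  ultimately show ?thesis by (simp add: smoothly_spreadable_ideal_def G)
qed

text \<open>
  The inclusions form a circle: a polynomial in both ideals has all its terms divisible by some
  \<open>a + b\<close>, these generate an ideal inside the product, and the product lies in the intersection.
\<close>

lemma separated_monomial_ideals_product:
  fixes A B :: "monom set"
  assumes A: "\<And>a. a \<in> A \<Longrightarrow> set_mset a \<subseteq> {1..n}" and B: "\<And>b. b \<in> B \<Longrightarrow> set_mset b \<subseteq> {1..n}"
    and disj: "\<And>a b. a \<in> A \<Longrightarrow> b \<in> B \<Longrightarrow> set_mset a \<inter> set_mset b = {}"
  defines "I \<equiv> Idl\<^bsub>T n\<^esub> (monomial ` A :: 'k::field polynomial set)"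
    and "J \<equiv> Idl\<^bsub>T n\<^esub> (monomial ` B :: 'k polynomial set)"
    and "P \<equiv> {a + b | a b. a \<in> A \<and> b \<in> B}"
  shows "I \<cdot>\<^bsub>T n\<^esub> J = I \<inter> J" "I \<cdot>\<^bsub>T n\<^esub> J = Idl\<^bsub>T n\<^esub> (monomial ` P)"
proof -
  interpret R: cring "T n :: 'k polynomial ring" by (rule cring_T)
  have carrA: "(monomial ` A :: 'k polynomial set) \<subseteq> carrier (T n)"
    and carrB: "(monomial ` B :: 'k polynomial set) \<subseteq> carrier (T n)"
    using A B monomial_carrier by blast+
  have I: "ideal I (T n)" and J: "ideal J (T n)"
    unfolding I_def J_def using carrA carrB by (auto intro: R.genideal_ideal)
  have P: "set_mset p \<subseteq> {1..n}" if "p \<in> P" for p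
    using that unfolding P_def by (elim CollectE exE conjE) (simp add: A B del: One_nat_def)
  have "\<exists>p\<in>P. p \<subseteq># w" if "a \<in> A" "a \<subseteq># w" "b \<in> B" "b \<subseteq># w" for a b w
  proof
    have "count (a + b) x \<le> count w x" for x
    proof -
      have "count a x = 0 \<or> count b x = 0"
        using disj[OF that(1,3)] by (auto simp: count_eq_zero_iff)
      then show ?thesis using that by (auto simp: subseteq_mset_def)
    qed
    then show "a + b \<subseteq># w" by (simp add: subseteq_mset_def)
    show "a + b \<in> P" using that by (auto simp: P_def)
  qed
  then have 1: "I \<inter> J \<subseteq> Idl\<^bsub>T n\<^esub> (monomial ` P)"
    unfolding I_def J_def using A B P by (simp add: Idl_monomials_eq) blast
  have "monomial (a + b) \<in> I \<cdot>\<^bsub>T n\<^esub> J" if "a \<in> A" "b \<in> B" for a b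
  proof -
    have "monomial a \<in> I" "monomial b \<in> J"
      unfolding I_def J_def using R.genideal_self[OF carrA] R.genideal_self[OF carrB] that by blast+
    from ideal_prod.prod[OF this, of "T n"] show ?thesis by (simp add: T_def monomial_mult)
  qed
  then have 2: "Idl\<^bsub>T n\<^esub> (monomial ` P) \<subseteq> I \<cdot>\<^bsub>T n\<^esub> J"
    by (intro R.genideal_minimal R.ideal_prod_is_ideal I J) (auto simp: P_def)
  have 3: "I \<cdot>\<^bsub>T n\<^esub> J \<subseteq> I \<inter> J" by (rule R.ideal_prod_inter[OF I J])
  show "I \<cdot>\<^bsub>T n\<^esub> J = I \<inter> J" "I \<cdot>\<^bsub>T n\<^esub> J = Idl\<^bsub>T n\<^esub> (monomial ` P)"
    using 1 2 3 by auto
qed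

section \<open>The product of two smoothly spreadable sets\<close>

theorem proposition1p15:
  fixes d d' n n' m m' :: nat
    and u v :: "nat \<Rightarrow> monom"
    and M M' I J :: "'k::field polynomial set"
  assumes "d' > d" "d \<ge> 1" "n' > n" "n \<ge> 1" "m \<ge> 1" "m' \<ge> 1"
    and M_def: "M = {monomial (u i) | i. i \<in> {1..m}}"
    and M'_def: "M' = {monomial (v k) | k. k \<in> {1..m'}}"
    and "M \<subseteq> monomials n" "M' \<subseteq> monomials n'"
    and deg_u: "\<And>i. i \<in> {1..m} \<Longrightarrow> size (u i) = d"
    and deg_v: "\<And>k. k \<in> {1..m'} \<Longrightarrow> size (v k) \<le> d' - d"
    and supp_v: "\<And>k. k \<in> {1..m'} \<Longrightarrow> set_mset (v k) \<subseteq> {n + 1..n'}"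
    and spread_u: "smoothly_spreadable n d M"
    and spread_v: "smoothly_spreadable n' (d' - d) M'"
    and I_def: "I = Idl\<^bsub>T n'\<^esub> M"
    and J_def: "J = Idl\<^bsub>T n'\<^esub> M'"
  shows "smoothly_spreadable n' d'
           {monomial (u i) * monomial (v k) :: 'k polynomial | i k. i \<in> {1..m} \<and> k \<in> {1..m'}} \<and>
         I \<cdot>\<^bsub>T n'\<^esub> J = I \<inter> J \<and>
         smoothly_spreadable_ideal n' (I \<cdot>\<^bsub>T n'\<^esub> J)"
proof -
  define U where "U = u ` {1..m}"
  define V where "V = v ` {1..m'}"
  define P where "P = {a + b | a b. a \<in> U \<and> b \<in> V}"
  have M: "M = monomial ` U" and M': "M' = monomial ` V"
    unfolding M_def M'_def U_def V_def by auto
  have prod: "{monomial (u i) * monomial (v k) :: 'k polynomial | i k. i \<in> {1..m} \<and> k \<in> {1..m'}}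
      = monomial ` P"
    unfolding P_def U_def V_def monomial_mult by blast
  have U: "finite U" "U \<noteq> {}" "\<And>a. a \<in> U \<Longrightarrow> set_mset a \<subseteq> {1..n} \<and> size a = d"
    and U_lev: "\<And>j. j \<in> {1..n} \<Longrightarrow> levelled j U"
    using spread_u deg_u unfolding M smoothly_spreadable_iff_levelled by (auto simp: U_def)
  have V: "finite V" "V \<noteq> {}" "\<And>b. b \<in> V \<Longrightarrow> set_mset b \<subseteq> {n + 1..n'} \<and> size b \<le> d' - d"
    and V_lev: "\<And>j. j \<in> {1..n'} \<Longrightarrow> levelled j V"
    using spread_v supp_v deg_v unfolding M' smoothly_spreadable_iff_levelled by (unfold V_def) blast+
  have lev: "levelled j P" if j: "j \<in> {1..n'}" for j
  proof -
    \<comment> \<open>A column beyond \<open>n\<close> is empty for \<open>U\<close>, so it is levelled by any map.\<close>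
    have "levelled j U"
    proof (cases "j \<le> n")
      case False
      then have "j \<notin># a" if "a \<in> U" for a using U(3)[OF that] by auto
      then show ?thesis by (simp add: levelled_def places_notin not_in_iff)
    qed (use U_lev j in auto)
    then show ?thesis
      unfolding P_def using U(3) V(3) V_lev[OF j] by (intro levelled_product[of U n d]) force+
  qed
  have spread: "smoothly_spreadable n' d' (monomial ` P :: 'k polynomial set)"
  proof -
    have "P = (\<lambda>(a, b). a + b) ` (U \<times> V)" by (auto simp: P_def)
    then have "finite P" "P \<noteq> {}" using U V by auto
    moreover have "set_mset p \<subseteq> {1..n'} \<and> size p \<le> d'" if p: "p \<in> P" for p
    proof -
      obtain a b where ab: "p = a + b" "a \<in> U" "b \<in> V" using p by (auto simp: P_def)
      have "set_mset a \<subseteq> {1..n'}" "set_mset b \<subseteq> {1..n'}"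
        using U(3)[OF ab(2)] V(3)[OF ab(3)] \<open>n' > n\<close> by force+
      then show ?thesis using ab U(3)[OF ab(2)] V(3)[OF ab(3)] \<open>d' > d\<close> by auto
    qed
    ultimately show ?thesis
      using lev \<open>d' > d\<close> unfolding smoothly_spreadable_iff_levelled by auto
  qed
  have disj: "set_mset a \<inter> set_mset b = {}" if "a \<in> U" "b \<in> V" for a b
    using U(3)[OF that(1)] V(3)[OF that(2)] by fastforce
  have "set_mset a \<subseteq> {1..n'}" if "a \<in> U" for a using U(3)[OF that] \<open>n' > n\<close> by force
  moreover have "set_mset b \<subseteq> {1..n'}" if "b \<in> V" for b using V(3)[OF that] by force
  ultimately have "I \<cdot>\<^bsub>T n'\<^esub> J = I \<inter> J" "I \<cdot>\<^bsub>T n'\<^esub> J = Idl\<^bsub>T n'\<^esub> (monomial ` P)"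
    using separated_monomial_ideals_product[of U n' V] disj unfolding I_def J_def M M' P_def by auto
  moreover have "{#} \<notin> P" using U(3)[of "{#}"] \<open>d \<ge> 1\<close> by (auto simp: P_def)
  ultimately show ?thesis
    unfolding prod using spread smoothly_spreadable_ideal_Idl[OF spread] by simp
qed

end
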